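(* Assume $(A,B)$ is stabilizable, $(A,Q^{1/2})$ is detectable, $P\succ0$ is the unique positive-definite DARE solution, the MPPI perturbations are i.i.d. Gaussian as in the context, and $\Sigma_\epsilon\succ0$. Fix a compact set $\mathcal X\subset\mathbb R^n$ and a bounded set $\mathcal U_N\subset\mathbb R^{mN}$. Then for any $\eta\in(0,1)$ there exist constants $C_{\mathcal X,\mathcal U}>0$ and $M_0(\eta)$, uniform over $\mathcal X\times\mathcal U_N$, such that for all $M\ge M_0(\eta)$, all $x_k\in\mathcal X$ and all $\bar U\in\mathcal U_N$, both $$\|u_k^{\mathrm{MPPI}}-u_k^{\infty}\|\le\varepsilon_M(\eta):=C_{\mathcal X,\mathcal U}\sqrt{\frac{\log(4m/\eta)}{M}}$$ and $$\|u_k^{\mathrm{MPPI}}-u_k^{\mathrm{LQR}}\|\le b_\infty(x_k,\bar U)+\varepsilon_M(\eta)$$ hold with probability at least $1-\eta$.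
   Context: Norms are Euclidean. $A\in\mathbb R^{n\times n}$, $B\in\mathbb R^{n\times m}$, $Q\succeq0$, $R\succ0$ symmetric. The DARE is $P=Q+A^\top PA-A^\top PB(R+B^\top PB)^{-1}B^\top PA$; $K=(R+B^\top PB)^{-1}B^\top PA$; $u_k^{\mathrm{LQR}}=-Kx_k$. For horizon $N\ge1$, state $x$ and $U=(u_0,\dots,u_{N-1})\in\mathbb R^{mN}$, $J(x,U)=\sum_{i=0}^{N-1}(x_i^\top Qx_i+u_i^\top Ru_i)+x_N^\top Px_N$ with noise-free prediction $x_0=x$, $x_{i+1}=Ax_i+Bu_i$. Fix temperature $\lambda>0$ and $\Sigma_\epsilon\in\mathbb R^{m\times m}$. Given a state $x_k$ and nominal sequence $\bar U=(\bar u_0,\dots,\bar u_{N-1})$, draw i.i.d. $\mathcal E^{(1)},\dots,\mathcal E^{(M)}\sim\mathcal N(0,I_N\otimes\Sigma_\epsilon)$ with first $m$-blocks $\epsilon_0^{(j)}$, put $w^{(j)}=\exp(-J(x_k,\bar U+\mathcal E^{(j)})/\lambda)$, and $u_k^{\mathrm{MPPI}}=\bar u_0+\big(\sum_{j=1}^Mw^{(j)}\epsilon_0^{(j)}\big)/\big(\sum_{j=1}^Mw^{(j)}\big)$. With $\mathcal E\sim\mathcal N(0,I_N\otimes\Sigma_\epsilon)$, first block $\epsilon_0$, and $w=\exp(-J(x_k,\bar U+\mathcal E)/\lambda)$, the infinite-sample control is $u_k^\infty=\bar u_0+\mathbb E[w\epsilon_0]/\mathbb E[w]$, and the bias is $b_\infty(x_k,\bar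 U)=\|u_k^\infty-u_k^{\mathrm{LQR}}\|$. Probability is over the samples, for each fixed $(x_k,\bar U)$. *)

theory Defs
  imports "HOL-Probability.Probability"
begin

definition psd :: "real^'k^'k \<Rightarrow> bool" where
  "psd S \<longleftrightarrow> transpose S = S \<and> (\<forall>v. 0 \<le> v \<bullet> (S *v v))"

definition pd :: "real^'k^'k \<Rightarrow> bool" where
  "pd S \<longleftrightarrow> transpose S = S \<and> (\<forall>v. v \<noteq> 0 \<longrightarrow> 0 < v \<bullet> (S *v v))"

(* The principal square root; a positive semidefinite matrix has exactly one, so the
   description is proper whenever S is positive semidefinite. *)
definition psd_sqrt :: "real^'k^'k \<Rightarrow> real^'k^'k" where
  "psd_sqrt S = (THE T. psd T \<and> T ** T = S)"

(* Discrete time: every complex eigenvalue lies in the open unit disc. *)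
definition schur_stable :: "real^'k^'k \<Rightarrow> bool" where
  "schur_stable S \<longleftrightarrow>
     (\<forall>(z::complex) (v::complex^'k).
        v \<noteq> 0 \<and> map_matrix complex_of_real S *v v = z *s v \<longrightarrow> cmod z < 1)"

definition stabilizable :: "real^'n^'n \<Rightarrow> real^'m^'n \<Rightarrow> bool" where
  "stabilizable A B \<longleftrightarrow> (\<exists>F::real^'n^'m. schur_stable (A - B ** F))"

definition detectable :: "real^'n^'n \<Rightarrow> real^'n^'p \<Rightarrow> bool" where
  "detectable A C \<longleftrightarrow> (\<exists>L::real^'p^'n. schur_stable (A - L ** C))"

definition dare ::
  "real^'n^'n \<Rightarrow> real^'m^'n \<Rightarrow> real^'n^'n \<Rightarrow> real^'m^'m \<Rightarrow> real^'n^'n \<Rightarrow> bool" where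
  "dare A B Q R P \<longleftrightarrow>
     P = Q + transpose A ** P ** A
           - transpose A ** P ** B ** matrix_inv (R + transpose B ** P ** B)
               ** transpose B ** P ** A"

definition lqr_gain ::
  "real^'n^'n \<Rightarrow> real^'m^'n \<Rightarrow> real^'m^'m \<Rightarrow> real^'n^'n \<Rightarrow> real^'n^'m" where
  "lqr_gain A B R P = matrix_inv (R + transpose B ** P ** B) ** transpose B ** P ** A"

definition u_lqr ::
  "real^'n^'n \<Rightarrow> real^'m^'n \<Rightarrow> real^'m^'m \<Rightarrow> real^'n^'n \<Rightarrow> real^'n \<Rightarrow> real^'m" where
  "u_lqr A B R P x = - (lqr_gain A B R P *v x)"

(* The horizon is N = CARD('h).  An element of R^(mN) is a vector over 'h \<times> 'm, so that
   its norm is the Euclidean one; the time steps 0, ..., N - 1 are the elements of 'h in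
   increasing order. *)
definition stage :: "nat \<Rightarrow> 'h::{finite,linorder}" where
  "stage i = sorted_list_of_set (UNIV::'h set) ! i"

(* The i-th m-block u_i of U = (u_0, ..., u_(N-1)), meaningful for i < N. *)
definition ublock :: "real^('h::{finite,linorder} \<times> 'm) \<Rightarrow> nat \<Rightarrow> real^'m" where
  "ublock U i = (\<chi> a. U $ (stage i, a))"

primrec pred_state ::
  "real^'n^'n \<Rightarrow> real^'m^'n \<Rightarrow> real^'n \<Rightarrow> real^('h::{finite,linorder} \<times> 'm) \<Rightarrow> nat
     \<Rightarrow> real^'n" where
  "pred_state A B x U 0 = x"
| "pred_state A B x U (Suc i) = A *v pred_state A B x U i + B *v ublock U i"

definition cost ::
  "real^'n^'n \<Rightarrow> real^'m^'n \<Rightarrow> real^'n^'n \<Rightarrow> real^'m^'m \<Rightarrow> real^'n^'n \<Rightarrow> real^'n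
     \<Rightarrow> real^('h::{finite,linorder} \<times> 'm) \<Rightarrow> real" where
  "cost A B Q R P x U =
     (\<Sum>i<CARD('h). pred_state A B x U i \<bullet> (Q *v pred_state A B x U i)
                    + ublock U i \<bullet> (R *v ublock U i))
     + pred_state A B x U CARD('h) \<bullet> (P *v pred_state A B x U CARD('h))"

definition kron :: "real^'a^'a \<Rightarrow> real^'b^'b \<Rightarrow> real^('a \<times> 'b)^('a \<times> 'b)" where
  "kron S T = (\<chi> p q. S $ fst p $ fst q * T $ snd p $ snd q)"

(* The law N(0, S), for positive definite S. *)
definition gaussian :: "real^'k^'k \<Rightarrow> (real^'k) measure" where
  "gaussian S = density lborel
     (\<lambda>z. ennreal (exp (- (z \<bullet> (matrix_inv S *v z)) / 2) / sqrt ((2 * pi) ^ CARD('k) * det S)))"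

definition noise_law :: "real^'m^'m \<Rightarrow> (real^('h::{finite,linorder} \<times> 'm)) measure" where
  "noise_law \<Sigma>\<^sub>\<epsilon> = gaussian (kron (mat 1) \<Sigma>\<^sub>\<epsilon>)"

definition iid_noise ::
  "real^'m^'m \<Rightarrow> 'w measure \<Rightarrow> nat \<Rightarrow> (nat \<Rightarrow> 'w \<Rightarrow> real^('h::{finite,linorder} \<times> 'm))
     \<Rightarrow> bool" where
  "iid_noise \<Sigma>\<^sub>\<epsilon> \<Omega> M E \<longleftrightarrow>
     prob_space \<Omega> \<and>
     prob_space.indep_vars \<Omega> (\<lambda>_. borel) E {1..M} \<and>
     (\<forall>j\<in>{1..M}. distr \<Omega> borel (E j) = noise_law \<Sigma>\<^sub>\<epsilon>)"

definition mppi_weight ::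
  "real^'n^'n \<Rightarrow> real^'m^'n \<Rightarrow> real^'n^'n \<Rightarrow> real^'m^'m \<Rightarrow> real^'n^'n \<Rightarrow> real \<Rightarrow> real^'n
     \<Rightarrow> real^('h::{finite,linorder} \<times> 'm) \<Rightarrow> real^('h \<times> 'm) \<Rightarrow> real" where
  "mppi_weight A B Q R P lam x U e = exp (- cost A B Q R P x (U + e) / lam)"

(* Here e j is the realised value of the j-th perturbation, j = 1, ..., M. *)
definition u_mppi ::
  "real^'n^'n \<Rightarrow> real^'m^'n \<Rightarrow> real^'n^'n \<Rightarrow> real^'m^'m \<Rightarrow> real^'n^'n \<Rightarrow> real \<Rightarrow> real^'n
     \<Rightarrow> real^('h::{finite,linorder} \<times> 'm) \<Rightarrow> nat \<Rightarrow> (nat \<Rightarrow> real^('h \<times> 'm)) \<Rightarrow> real^'m" where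
  "u_mppi A B Q R P lam x U M e =
     ublock U 0
     + (\<Sum>j=1..M. mppi_weight A B Q R P lam x U (e j) *\<^sub>R ublock (e j) 0)
         /\<^sub>R (\<Sum>j=1..M. mppi_weight A B Q R P lam x U (e j))"

definition u_inf ::
  "real^'n^'n \<Rightarrow> real^'m^'n \<Rightarrow> real^'n^'n \<Rightarrow> real^'m^'m \<Rightarrow> real^'n^'n \<Rightarrow> real \<Rightarrow> real^'m^'m
     \<Rightarrow> real^'n \<Rightarrow> real^('h::{finite,linorder} \<times> 'm) \<Rightarrow> real^'m" where
  "u_inf A B Q R P lam \<Sigma>\<^sub>\<epsilon> x U =
     ublock U 0
     + (LINT e|noise_law \<Sigma>\<^sub>\<epsilon>. mppi_weight A B Q R P lam x U e *\<^sub>R ublock e 0)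
         /\<^sub>R (LINT e|noise_law \<Sigma>\<^sub>\<epsilon>. mppi_weight A B Q R P lam x U e)"

definition bias_inf ::
  "real^'n^'n \<Rightarrow> real^'m^'n \<Rightarrow> real^'n^'n \<Rightarrow> real^'m^'m \<Rightarrow> real^'n^'n \<Rightarrow> real \<Rightarrow> real^'m^'m
     \<Rightarrow> real^'n \<Rightarrow> real^('h::{finite,linorder} \<times> 'm) \<Rightarrow> real" where
  "bias_inf A B Q R P lam \<Sigma>\<^sub>\<epsilon> x U = norm (u_inf A B Q R P lam \<Sigma>\<^sub>\<epsilon> x U - u_lqr A B R P x)"

end

theory Submission
  imports Defs
begin

text \<open>
  Since \<open>J(x, U) \<ge> u\<^sub>0\<^sup>T R u\<^sub>0\<close> is coercive in the first input, not only the weight \<open>w\<close> but also the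
  weighted noise \<open>w \<epsilon>\<^sub>0\<close> is bounded, uniformly over a bounded set of nominal sequences. Hence
  Hoeffding's inequality applies to \<open>w\<close> and to each of the \<open>m\<close> coordinates of \<open>w \<epsilon>\<^sub>0\<close>; each of these
  \<open>m + 1 \<le> 2m\<close> two-sided events is given failure probability \<open>\<eta> / (2m)\<close>. By compactness \<open>J\<close> is
  bounded on a ball of noise carrying half the mass, so \<open>E[w]\<close> is bounded away from zero uniformly,
  and for large \<open>M\<close> so is the empirical denominator; the two deviations then control the quotient.
\<close>

section \<open>Concentration of self-normalised averages\<close>

text \<open>Two-sided Hoeffding, phrased through the common law \<open>\<mu>\<close> of the samples
  so that it applies to several functions \<open>f\<close> of the same sample. The variables
  \<open>f (E i \<omega>)\<close> all have the push-forward of \<open>\<mu>\<close> under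
  \<open>f\<close> as law; a fixed index \<open>i0\<close> supplies the reference variable, whose
  expectation is the integral of \<open>f\<close> against \<open>\<mu>\<close>.\<close>

lemma Hoeffding_empirical_mean:
  fixes f :: "'a \<Rightarrow> real"
  assumes "prob_space \<Omega>" and indep: "prob_space.indep_vars \<Omega> (\<lambda>_. N) E I"
    and I: "finite I" "I \<noteq> {}"
    and law: "\<And>i. i \<in> I \<Longrightarrow> distr \<Omega> N (E i) = \<mu>"
    and f [measurable]: "f \<in> borel_measurable N"
    and bd: "\<And>y. f y \<in> {a..b}" and "a < b" "0 \<le> s"
  shows "measure \<Omega> {\<omega> \<in> space \<Omega>. s \<le> \<bar>(\<Sum>i\<in>I. f (E i \<omega>)) / real (card I) - integral\<^sup>L \<mu> f\<bar>}
           \<le> 2 * exp (- 2 * real (card I) * s\<^sup>2 / (b - a)\<^sup>2)"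
proof -
  interpret prob_space \<Omega> by fact
  have E: "E i \<in> measurable \<Omega> N" if "i \<in> I" for i
    using indep that unfolding indep_vars_def by blast
  obtain i0 where i0: "i0 \<in> I" using I by blast
  note [measurable] = E[OF i0]
  have d: "distr \<Omega> borel (\<lambda>\<omega>. f (E i \<omega>)) = distr \<mu> borel f" if "i \<in> I" for i
    using distr_distr[OF f E[OF that]] law[OF that] by (simp add: comp_def)
  have mu: "integral\<^sup>L \<mu> f = expectation (\<lambda>\<omega>. f (E i0 \<omega>))"
    using law[OF i0] by (subst law[OF i0, symmetric], subst integral_distr) auto
  interpret Hoeffding_ineq_iid \<Omega> I "\<lambda>i \<omega>. f (E i \<omega>)" "\<lambda>\<omega>. f (E i0 \<omega>)" a b "integral\<^sup>L \<mu> f"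
  proof (unfold_locales, goal_cases)
    case 2 show ?case by (rule indep_vars_compose2[OF indep]) simp
  next
    case (3 i) then show ?case using d[OF 3] d[OF i0] by simp
  next
    case 5 show ?case using bd by simp
  qed (use I mu in auto)
  show ?thesis using Hoeffding_ineq_abs_ge'[of s] I \<open>a < b\<close> \<open>0 \<le> s\<close> by simp
qed

text \<open>The difference splits into (G - H)/V and (1/V - 1/W) H. The first factor 1/V is at most
  2/c, and |1/V - 1/W| = |V - W|/(VW) is at most 2t/c^2. This deterministic estimate turns separate
  deviations of numerator and denominator into one for the ratio.\<close>

lemma norm_quotient_diff_le:
  fixes G H :: "'a::real_normed_vector"
  assumes "0 < c" "c \<le> W" "c / 2 \<le> V" "norm H \<le> D" "norm (G - H) \<le> s" "\<bar>V - W\<bar> \<le> t"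
  shows "norm (G /\<^sub>R V - H /\<^sub>R W) \<le> 2 * s / c + 2 * D * t / c\<^sup>2"
proof -
  have V: "0 < V" and W: "0 < W" using assms by linarith+
  have iV: "inverse V \<le> 2 / c" using assms V by (simp add: field_simps)
  have iW: "inverse W \<le> 1 / c" using assms W by (simp add: field_simps)
  have "inverse V - inverse W = (W - V) * (inverse V * inverse W)"
    using V W by (simp add: field_simps)
  then have "\<bar>inverse V - inverse W\<bar> = \<bar>V - W\<bar> * (inverse V * inverse W)"
    using V W by (simp add: abs_mult abs_minus_commute)
  also have "\<dots> \<le> t * (2 / c * (1 / c))"
    using assms V W iV iW by (intro mult_mono) auto
  finally have d: "\<bar>inverse V - inverse W\<bar> \<le> 2 * t / c\<^sup>2"
    by (simp add: power2_eq_square field_simps)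
  have "G /\<^sub>R V - H /\<^sub>R W = inverse V *\<^sub>R (G - H) + (inverse V - inverse W) *\<^sub>R H"
    by (simp add: algebra_simps)
  then have "norm (G /\<^sub>R V - H /\<^sub>R W)
      \<le> inverse V * norm (G - H) + \<bar>inverse V - inverse W\<bar> * norm H"
    using V by (metis norm_triangle_ineq norm_scaleR abs_of_pos inverse_positive_iff_positive)
  also have "\<dots> \<le> 2 / c * s + 2 * t / c\<^sup>2 * D"
    using assms V iV d by (intro add_mono mult_mono) auto
  finally show ?thesis by (simp add: field_simps)
qed

text \<open>A union bound over the denominator and the coordinates of the numerator, followed by the
  quotient estimate. The coefficient depends only on \<open>c\<close>, \<open>D\<close> and the
  dimension, so any family with common \<open>c\<close> and \<open>D\<close> gets a uniform
  bound.\<close>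

lemma self_normalised_concentration:
  fixes w :: "'a \<Rightarrow> real" and g :: "'a \<Rightarrow> real^'m" and I :: "'i set"
  assumes "prob_space \<Omega>" and indep: "prob_space.indep_vars \<Omega> (\<lambda>_. N) E I"
    and I: "finite I" "I \<noteq> {}"
    and law: "\<And>i. i \<in> I \<Longrightarrow> distr \<Omega> N (E i) = \<mu>"
    and w [measurable]: "w \<in> borel_measurable N" and w01: "\<And>y. w y \<in> {0..1}"
    and g [measurable]: "g \<in> borel_measurable N" and gD: "\<And>y. norm (g y) \<le> D" and "0 < D"
    and "0 < c" and cw: "c \<le> integral\<^sup>L \<mu> w"
    and \<eta>: "0 < \<eta>" "\<eta> < 1"
    and big: "2 * ln (4 * real CARD('m) / \<eta>) / c\<^sup>2 \<le> real (card I)"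
  shows "measure \<Omega> {\<omega> \<in> space \<Omega>.
           norm ((\<Sum>i\<in>I. g (E i \<omega>)) /\<^sub>R (\<Sum>i\<in>I. w (E i \<omega>)) - integral\<^sup>L \<mu> g /\<^sub>R integral\<^sup>L \<mu> w)
           \<le> (2 * sqrt 2 * real CARD('m) * D / c + sqrt 2 * D / c\<^sup>2)
               * sqrt (ln (4 * real CARD('m) / \<eta>) / real (card I))} \<ge> 1 - \<eta>"
    (is "measure \<Omega> {\<omega> \<in> space \<Omega>. ?dev \<omega> \<le> ?\<epsilon>} \<ge> _")
proof -
  interpret prob_space \<Omega> by fact
  have E: "E i \<in> measurable \<Omega> N" if "i \<in> I" for i
    using indep that unfolding indep_vars_def by blast
  have [measurable]: "(\<lambda>\<omega>. w (E i \<omega>)) \<in> borel_measurable \<Omega>"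
      "(\<lambda>\<omega>. g (E i \<omega>)) \<in> borel_measurable \<Omega>" if "i \<in> I" for i
    using E[OF that] by measurable
  obtain i0 where i0: "i0 \<in> I" using I by blast
  interpret \<mu>: prob_space \<mu> using law[OF i0] prob_space_distr[OF E[OF i0]] by simp
  have sets\<mu> [measurable_cong]: "sets \<mu> = sets N" using law[OF i0] by auto
  define m where "m = real CARD('m)"
  define n where "n = real (card I)"
  define L where "L = ln (4 * m / \<eta>)"
  have m: "m \<ge> 1" unfolding m_def by (simp add: Suc_le_eq)
  have n: "n > 0" unfolding n_def using I by (simp add: card_gt_0_iff)
  have "4 * m / \<eta> > 1" using m \<eta> by (simp add: field_simps)
  then have L: "L > 0" and eL: "exp (- L) = \<eta> / (4 * m)"
    using \<eta> m by (auto simp: L_def exp_minus)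
  \<comment> \<open>The radii solve 2 exp(-2 n s^2 / (2D)^2) = 2 exp(-L) and 2 exp(-2 n t^2) = 2
    exp(-L): coordinates of \<open>g\<close> range over an interval of length 2D, values of
    \<open>w\<close> over one of length 1. Each tail is then \<eta>/(2m).\<close>
  define s where "s = D * sqrt (2 * L / n)"
  define t where "t = sqrt (L / (2 * n))"
  have st: "s \<ge> 0" "t \<ge> 0" unfolding s_def t_def using L n \<open>0 < D\<close> by auto
  have ig: "integrable \<mu> g"
    by (rule \<mu>.integrable_const_bound[where B = D]) (use gD in auto)
  define V where "V \<omega> = (\<Sum>i\<in>I. w (E i \<omega>)) / n" for \<omega>
  define G where "G \<omega> = (\<Sum>i\<in>I. g (E i \<omega>)) /\<^sub>R n" for \<omega>
  define W where "W = integral\<^sup>L \<mu> w"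
  define H where "H = integral\<^sup>L \<mu> g"
  define Bw where "Bw = {\<omega> \<in> space \<Omega>. t \<le> \<bar>V \<omega> - W\<bar>}"
  define Bg where "Bg a = {\<omega> \<in> space \<Omega>. s \<le> \<bar>G \<omega> $ a - H $ a\<bar>}" for a
  have mV [measurable]: "V \<in> borel_measurable \<Omega>" unfolding V_def by measurable
  have mG [measurable]: "G \<in> borel_measurable \<Omega>" unfolding G_def by measurable
  have "prob Bw \<le> 2 * exp (- 2 * real (card I) * t\<^sup>2 / (1 - 0)\<^sup>2)"
    unfolding Bw_def V_def W_def n_def
    by (rule Hoeffding_empirical_mean[OF \<open>prob_space \<Omega>\<close> indep I law w]) (use w01 st in auto)
  also have "- 2 * real (card I) * t\<^sup>2 / (1 - 0)\<^sup>2 = - L"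
    using n L by (simp add: t_def n_def[symmetric])
  finally have Bw: "prob Bw \<le> \<eta> / (2 * m)" using eL by (simp add: field_simps)
  have Bg: "prob (Bg a) \<le> \<eta> / (2 * m)" for a
  proof -
    have "(\<lambda>y. g y \<bullet> axis a 1) \<in> borel_measurable N" by measurable
    then have ma: "(\<lambda>y. g y $ a) \<in> borel_measurable N" by (simp add: inner_axis)
    have c: "\<bar>g y $ a\<bar> \<le> D" for y using component_le_norm_cart[of "g y" a] gD[of y] by linarith
    have "integral\<^sup>L \<mu> (\<lambda>y. g y $ a) = H $ a"
      using integral_inner_left[of "axis a 1" \<mu> g] ig by (simp add: H_def inner_axis)
    moreover have "(\<Sum>i\<in>I. g (E i \<omega>) $ a) / n = G \<omega> $ a" for \<omega>
      by (simp add: G_def field_simps)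
    ultimately have eq: "Bg a = {\<omega> \<in> space \<Omega>.
        s \<le> \<bar>(\<Sum>i\<in>I. g (E i \<omega>) $ a) / real (card I) - integral\<^sup>L \<mu> (\<lambda>y. g y $ a)\<bar>}"
      by (simp add: Bg_def n_def)
    have "prob (Bg a) \<le> 2 * exp (- 2 * real (card I) * s\<^sup>2 / (D - - D)\<^sup>2)"
      unfolding eq
      by (rule Hoeffding_empirical_mean[OF \<open>prob_space \<Omega>\<close> indep I law ma])
        (use c st \<open>0 < D\<close> in \<open>auto simp: abs_le_iff minus_le_iff\<close>)
    also have "- 2 * real (card I) * s\<^sup>2 / (D - - D)\<^sup>2 = - L"
      using n L \<open>0 < D\<close> by (simp add: s_def n_def[symmetric] power_mult_distrib)
    finally show ?thesis using eL by (simp add: field_simps)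
  qed
  have mB [measurable]: "Bw \<in> sets \<Omega>" "Bg a \<in> sets \<Omega>" for a
    unfolding Bw_def Bg_def by measurable
  have "prob (Bw \<union> (\<Union>a. Bg a)) \<le> prob Bw + (\<Sum>a\<in>UNIV. prob (Bg a))"
    by (intro order_trans[OF measure_Un_le] add_left_mono
        finite_measure_subadditive_finite) auto
  also have "\<dots> \<le> \<eta> / (2 * m) + m * (\<eta> / (2 * m))"
    unfolding m_def by (intro add_mono Bw[unfolded m_def] sum_bounded_above Bg[unfolded m_def])
  \<comment> \<open>Here m \<ge> 1 absorbs the denominator's event: \<eta>/(2m) \<le>
    \<eta>/2.\<close>
  also have "\<dots> \<le> \<eta> / 2 + \<eta> / 2"
    using m \<eta> by (intro add_mono divide_left_mono) auto
  finally have bad: "prob (Bw \<union> (\<Union>a. Bg a)) \<le> \<eta>" by simp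
  \<comment> \<open>The lower bound on the sample size enters here: off the bad events the empirical
    denominator is at least c - t \<ge> c/2.\<close>
  have t_half: "t \<le> c / 2"
  proof -
    have "2 * L \<le> c\<^sup>2 * n" using big \<open>0 < c\<close> by (simp add: L_def m_def n_def field_simps)
    then have "L / (2 * n) \<le> (c / 2)\<^sup>2" using n by (simp add: field_simps)
    then show ?thesis unfolding t_def using \<open>0 < c\<close> by (intro real_le_lsqrt) (use L n in auto)
  qed
  have HD: "norm H \<le> D"
  proof -
    have "norm H \<le> (\<integral>y. norm (g y) \<partial>\<mu>)" unfolding H_def by (rule integral_norm_bound)
    also have "\<dots> \<le> D" using gD ig by (intro \<mu>.integral_le_const) auto
    finally show ?thesis .
  qed
  have good: "?dev \<omega> \<le> ?\<epsilon>" if "\<omega> \<in> space \<Omega> - (Bw \<union> (\<Union>a. Bg a))" for \<omega>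
  proof -
    have V: "\<bar>V \<omega> - W\<bar> \<le> t" using that by (auto simp: Bw_def)
    \<comment> \<open>Passing from coordinates to the Euclidean norm through the l1 norm costs the
      factor m in the first term of the coefficient.\<close>
    have "norm (G \<omega> - H) \<le> (\<Sum>a\<in>UNIV. \<bar>(G \<omega> - H) $ a\<bar>)" by (rule norm_le_l1_cart)
    also have "\<dots> \<le> m * s" unfolding m_def
      by (rule sum_bounded_above) (use that in \<open>auto simp: Bg_def not_le less_imp_le\<close>)
    finally have G: "norm (G \<omega> - H) \<le> m * s" .
    have "norm (G \<omega> /\<^sub>R V \<omega> - H /\<^sub>R W) \<le> 2 * (m * s) / c + 2 * D * t / c\<^sup>2"
      using V t_half cw \<open>0 < c\<close> by (intro norm_quotient_diff_le HD G V) (auto simp: W_def)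
    also have "\<dots> = (2 * sqrt 2 * m * D / c + sqrt 2 * D / c\<^sup>2) * sqrt (L / n)"
    proof -
      have "t = sqrt 2 / 2 * sqrt (L / n)"
        using real_sqrt_mult[of 2 "L / (2 * n)"] real_sqrt_mult_self[of 2]
        by (simp add: t_def mult.assoc[symmetric] field_simps)
      moreover have "s = D * (sqrt 2 * sqrt (L / n))"
        unfolding s_def by (simp flip: real_sqrt_mult)
      ultimately show ?thesis by (simp add: algebra_simps)
    qed
    \<comment> \<open>The common factor 1/n cancels, so the ratio of means is the ratio of
      sums.\<close>
    also have "G \<omega> /\<^sub>R V \<omega> = (\<Sum>i\<in>I. g (E i \<omega>)) /\<^sub>R (\<Sum>i\<in>I. w (E i \<omega>))"
      using n by (simp add: G_def V_def inverse_eq_divide)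
    finally show ?thesis by (simp add: m_def n_def L_def H_def W_def)
  qed
  have "1 - \<eta> \<le> prob (space \<Omega> - (Bw \<union> (\<Union>a. Bg a)))"
    using bad by (subst prob_compl) auto
  also have "\<dots> \<le> prob {\<omega> \<in> space \<Omega>. ?dev \<omega> \<le> ?\<epsilon>}"
  proof (rule finite_measure_mono)
    \<comment> \<open>Monotonicity of the measure requires the larger set to be an event.\<close>
    show "{\<omega> \<in> space \<Omega>. ?dev \<omega> \<le> ?\<epsilon>} \<in> events" by measurable
  qed (use good in auto)
  finally show ?thesis .
qed

section \<open>The prediction cost and the weights\<close>

text \<open>The constant is the minimum of the quadratic form over the unit sphere, attained by
  compactness and positive by definiteness. Homogeneity of degree two carries the bound from
  \<open>sgn v\<close> to \<open>v\<close>.\<close>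

lemma pd_coercive:
  fixes R :: "real^'m^'m"
  assumes "pd R"
  obtains r where "0 < r" "\<And>v. r * (norm v)\<^sup>2 \<le> v \<bullet> (R *v v)"
proof -
  have "continuous_on (sphere 0 1) (\<lambda>v. v \<bullet> (R *v v))" by (intro continuous_intros)
  moreover have "axis undefined 1 \<in> sphere (0::real^'m) 1" by simp
  ultimately obtain u where u: "u \<in> sphere 0 1"
      "\<And>v. v \<in> sphere 0 1 \<Longrightarrow> u \<bullet> (R *v u) \<le> v \<bullet> (R *v v)"
    using continuous_attains_inf[of "sphere 0 1" "\<lambda>v. v \<bullet> (R *v v)"] by (metis compact_sphere empty_iff)
  show ?thesis
  proof
    show "0 < u \<bullet> (R *v u)" using assms u(1) unfolding pd_def by (metis norm_zero zero_neq_one mem_sphere_0)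
    fix v
    show "u \<bullet> (R *v u) * (norm v)\<^sup>2 \<le> v \<bullet> (R *v v)"
    proof (cases "v = 0")
      case False
      have "u \<bullet> (R *v u) \<le> sgn v \<bullet> (R *v sgn v)"
        using False by (intro u(2)) (simp add: norm_sgn)
      also have "\<dots> = v \<bullet> (R *v v) / (norm v)\<^sup>2"
        by (simp add: sgn_div_norm matrix_vector_mult_scaleR power2_eq_square field_simps)
      finally show ?thesis using False by (simp add: field_simps)
    qed simp
  qed
qed

lemma ublock_add: "ublock (U + V) i = ublock U i + ublock V i"
  by (simp add: ublock_def vec_eq_iff)

lemma continuous_on_ublock [continuous_intros]:
  "continuous_on S f \<Longrightarrow> continuous_on S (\<lambda>x. ublock (f x) i)"
  unfolding ublock_def by (intro continuous_intros)

text \<open>A block is a subvector, so its sum of squares is part of the full sum. No range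
  condition on \<open>i\<close> is imposed, since \<open>stage i\<close> is always some element of
  the index type.\<close>

lemma norm_ublock_le: "norm (ublock U i) \<le> norm U"
proof -
  have "(norm (ublock U i))\<^sup>2 = (\<Sum>p\<in>Pair (stage i) ` UNIV. (U $ p)\<^sup>2)"
    by (simp add: norm_vec_def L2_set_def sum_nonneg ublock_def sum.reindex inj_on_def)
  also have "\<dots> \<le> (\<Sum>p\<in>UNIV. (U $ p)\<^sup>2)" by (intro sum_mono2) auto
  also have "\<dots> = (norm U)\<^sup>2"
    by (simp add: norm_vec_def L2_set_def sum_nonneg)
  finally show ?thesis by (simp add: power2_le_iff_abs_le)
qed

lemma continuous_on_pred_state [continuous_intros]:
  "continuous_on S f \<Longrightarrow> continuous_on S g \<Longrightarrow> continuous_on S (\<lambda>p. pred_state A B (f p) (g p) i)"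
  by (induction i)
    (auto intro!: continuous_intros matrix_vector_mult_linear_continuous_on[THEN continuous_on_compose2])

text \<open>Joint continuity in state and input serves twice: for compactness over a product set,
  and with the state fixed for measurability of the weight.\<close>

lemma continuous_on_cost [continuous_intros]:
  assumes "continuous_on S f" "continuous_on S g"
  shows "continuous_on S (\<lambda>p. cost A B Q R P (f p) (g p))"
  unfolding cost_def
  by (intro continuous_intros assms
      matrix_vector_mult_linear_continuous_on[THEN continuous_on_compose2]) auto

lemma first_input_cost_le_cost:
  fixes U :: "real^('h::{finite,linorder} \<times> 'm::finite)"
  assumes "psd Q" "pd R" "pd P"
  shows "ublock U 0 \<bullet> (R *v ublock U 0) \<le> cost A B Q R P x U"
proof -
  have Q: "0 \<le> v \<bullet> (Q *v v)" for v using assms by (simp add: psd_def)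
  have R: "0 \<le> v \<bullet> (R *v v)" for v
    using assms by (cases "v = 0") (auto simp: pd_def less_imp_le)
  have P: "0 \<le> v \<bullet> (P *v v)" for v
    using assms by (cases "v = 0") (auto simp: pd_def less_imp_le)
  let ?f = "\<lambda>i. pred_state A B x U i \<bullet> (Q *v pred_state A B x U i) + ublock U i \<bullet> (R *v ublock U i)"
  \<comment> \<open>Stage 0 occurs in the sum because the horizon \<open>CARD('h)\<close> is at
    least 1.\<close>
  have "?f 0 \<le> sum ?f {..<CARD('h)}"
    by (rule member_le_sum) (auto intro: add_nonneg_nonneg Q R)
  then have "ublock U 0 \<bullet> (R *v ublock U 0) \<le> sum ?f {..<CARD('h)}"
    using Q[of "pred_state A B x U 0"] by linarith
  then show ?thesis unfolding cost_def using P by (simp add: add_increasing2)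
qed

section \<open>Boundedness of the weight and of the weighted noise\<close>

lemma mult_exp_neg_square_le:
  fixes \<alpha> t :: real
  assumes "0 < \<alpha>"
  shows "t * exp (- (\<alpha> * t\<^sup>2)) \<le> 1 + 1 / \<alpha>"
proof -
  \<comment> \<open>Linear growth is dominated by a quadratic, and 1 + \<alpha> t^2 by its
    exponential; the resulting constant is independent of \<open>t\<close>.\<close>
  have "t \<le> 1 + t\<^sup>2" using zero_le_power2[of "t - 1 / 2"] by (simp add: power2_eq_square algebra_simps)
  also have "\<dots> \<le> (1 + 1 / \<alpha>) * (1 + \<alpha> * t\<^sup>2)" using assms by (simp add: field_simps)
  also have "\<dots> \<le> (1 + 1 / \<alpha>) * exp (\<alpha> * t\<^sup>2)" using assms by (intro mult_left_mono) auto
  finally show ?thesis by (simp add: exp_minus field_simps)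
qed

lemma mppi_weight_bounds:
  assumes "psd Q" "pd R" "pd P" "lam > 0"
  shows "mppi_weight A B Q R P lam x U e \<in> {0..1}"
proof -
  have "0 \<le> ublock (U + e) 0 \<bullet> (R *v ublock (U + e) 0)"
    using assms(2) by (cases "ublock (U + e) 0 = 0") (auto simp: pd_def less_imp_le)
  then have "0 \<le> cost A B Q R P x (U + e)"
    using first_input_cost_le_cost[OF assms(1-3)] order_trans by blast
  then show ?thesis using assms by (simp add: mppi_weight_def)
qed

text \<open>The weight has Gaussian decay in the perturbed input, not in the noise itself. Writing
  the noise as perturbed minus nominal input, the perturbed part is controlled by the decay with
  rate \<open>r / lam\<close>, and the nominal part by \<open>norm U\<close> because the weight is
  at most 1. The bound is uniform in \<open>x\<close> and \<open>e\<close>, as Hoeffding requires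
  although the noise is unbounded.\<close>

lemma norm_weighted_noise_le:
  assumes "psd Q" "pd R" "pd P" "lam > 0"
    and r: "0 < r" "\<And>v. r * (norm v)\<^sup>2 \<le> v \<bullet> (R *v v)"
  shows "norm (mppi_weight A B Q R P lam x U e *\<^sub>R ublock e 0) \<le> 1 + lam / r + norm U"
proof -
  let ?w = "mppi_weight A B Q R P lam x U e" and ?u = "norm (ublock (U + e) 0)"
  have w: "0 \<le> ?w" "?w \<le> 1" using mppi_weight_bounds[OF assms(1-4), of A B x U e] by auto
  have "r * ?u\<^sup>2 \<le> cost A B Q R P x (U + e)"
    using r(2) first_input_cost_le_cost[OF assms(1-3)] order_trans by blast
  then have "?w \<le> exp (- (r / lam * ?u\<^sup>2))"
    using \<open>lam > 0\<close> by (simp add: mppi_weight_def divide_right_mono)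
  then have "?u * ?w \<le> ?u * exp (- (r / lam * ?u\<^sup>2))" by (intro mult_left_mono) auto
  also have "\<dots> \<le> 1 + lam / r"
    using mult_exp_neg_square_le[of "r / lam" ?u] r \<open>lam > 0\<close> by simp
  finally have 1: "?u * ?w \<le> 1 + lam / r" .
  have "norm (ublock e 0) \<le> ?u + norm (ublock U 0)"
    by (metis add_diff_cancel_left' norm_triangle_ineq4 ublock_add)
  also have "\<dots> \<le> ?u + norm U" using norm_ublock_le by auto
  finally have "?w * norm (ublock e 0) \<le> ?w * (?u + norm U)" using w by (intro mult_left_mono)
  also have "\<dots> = ?u * ?w + ?w * norm U" by (simp add: algebra_simps)
  also have "\<dots> \<le> 1 + lam / r + 1 * norm U" using w 1 by (intro add_mono mult_right_mono) auto
  finally show ?thesis using w by simp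
qed

lemma borel_measurable_mppi_weight [measurable]:
  "mppi_weight A B Q R P lam x U \<in> borel_measurable borel"
  unfolding mppi_weight_def divide_inverse
  by (intro borel_measurable_continuous_onI continuous_intros)

lemma borel_measurable_ublock [measurable]: "(\<lambda>e. ublock e i) \<in> borel_measurable borel"
  by (intro borel_measurable_continuous_onI continuous_intros)

section \<open>Uniform lower bound on the expected weight\<close>

lemma exists_cball_half:
  fixes a :: "'a::metric_space"
  assumes "prob_space M" and sets [measurable_cong]: "sets M = sets borel"
  obtains \<rho> where "1 / 2 \<le> measure M (cball a \<rho>)"
proof -
  interpret prob_space M by fact
  \<comment> \<open>Balls of integer radius increase to the whole space, so by continuity from below
    their probabilities tend to 1 and eventually exceed 1/2.\<close>
  have "(\<lambda>n. prob (cball a (real n))) \<longlonglongrightarrow> prob (\<Union>n. cball a (real n))"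
    by (rule finite_Lim_measure_incseq) (auto simp: incseq_def)
  moreover have "(\<Union>n. cball a (real n)) = space M"
    using sets_eq_imp_space_eq[OF sets] by (auto intro: real_arch_simple)
  ultimately have "(\<lambda>n. prob (cball a (real n))) \<longlonglongrightarrow> 1" by (simp add: prob_space)
  then have "eventually (\<lambda>n. 1 / 2 < prob (cball a (real n))) sequentially"
    by (rule order_tendstoD) simp
  then show ?thesis by (meson eventually_sequentially order_refl less_imp_le that)
qed

lemma mppi_weight_expectation_bounded_below:
  fixes US :: "(real^('h::{finite,linorder} \<times> 'm::finite)) set"
  assumes "psd Q" "pd R" "pd P" "lam > 0" and X: "compact X" and US: "bounded US"
    and "prob_space \<mu>" and sets\<mu> [measurable_cong]: "sets \<mu> = sets borel"
  obtains c where "0 < c"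
    "\<And>x U. x \<in> X \<Longrightarrow> U \<in> US \<Longrightarrow> c \<le> (LINT e|\<mu>. mppi_weight A B Q R P lam x U e)"
proof -
  interpret prob_space \<mu> by fact
  obtain \<rho> where \<rho>: "1 / 2 \<le> prob (cball 0 \<rho>)" by (rule exists_cball_half[OF \<open>prob_space \<mu>\<close> sets\<mu>])
  obtain K where K: "\<And>U. U \<in> US \<Longrightarrow> norm U \<le> K" using US by (auto simp: bounded_iff)
  \<comment> \<open>The radius \<open>K + \<rho>\<close> captures \<open>U + e\<close> for every
    nominal \<open>U\<close> and every noise \<open>e\<close> in the half-mass ball, so a single
    cost bound \<open>J\<close> covers all of them and all states.\<close>
  have "compact ((\<lambda>p. cost A B Q R P (fst p) (snd p)) ` (X \<times> cball (0::real^('h \<times> 'm)) (K + \<rho>)))"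
    by (intro compact_continuous_image compact_Times X compact_cball continuous_intros)
  then have "bounded ((\<lambda>p. cost A B Q R P (fst p) (snd p)) ` (X \<times> cball (0::real^('h \<times> 'm)) (K + \<rho>)))"
    by (rule compact_imp_bounded)
  then obtain J where J: "\<And>x U. x \<in> X \<Longrightarrow> U \<in> cball (0::real^('h \<times> 'm)) (K + \<rho>)
      \<Longrightarrow> \<bar>cost A B Q R P x U\<bar> \<le> J"
    by (force simp: bounded_iff)
  show ?thesis
  proof
    show "0 < exp (- J / lam) / 2" by simp
    fix x U assume x: "x \<in> X" and U: "U \<in> US"
    have w: "mppi_weight A B Q R P lam x U e \<in> {0..1}" for e
      using mppi_weight_bounds[OF assms(1-4)] .
    have "exp (- J / lam) / 2 \<le> exp (- J / lam) * prob (cball 0 \<rho>)" using \<rho> by simp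
    also have "\<dots> = (LINT e|\<mu>. exp (- J / lam) * indicator (cball 0 \<rho>) e)"
      by simp
    \<comment> \<open>On the ball the weight is at least \<open>exp (- J / lam)\<close>; outside it,
      nonnegativity suffices.\<close>
    also have "\<dots> \<le> (LINT e|\<mu>. mppi_weight A B Q R P lam x U e)"
    proof (rule integral_mono)
      show "integrable \<mu> (\<lambda>e. mppi_weight A B Q R P lam x U e)"
        by (rule integrable_const_bound[where B = 1]) (use w in auto)
      fix e :: "real^('h \<times> 'm)"
      show "exp (- J / lam) * indicator (cball 0 \<rho>) e \<le> mppi_weight A B Q R P lam x U e"
      proof (cases "e \<in> cball 0 \<rho>")
        case True
        then have "U + e \<in> cball 0 (K + \<rho>)" using K[OF U] norm_triangle_ineq[of U e] by simp
        from J[OF x this] show ?thesis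
          using True \<open>lam > 0\<close> by (simp add: mppi_weight_def divide_right_mono)
      qed (use w[of e] in simp)
    qed (auto intro: integrable_mult_right integrable_real_indicator simp: emeasure_eq_measure)
    finally show "exp (- J / lam) / 2 \<le> (LINT e|\<mu>. mppi_weight A B Q R P lam x U e)" .
  qed
qed

section \<open>Uniform constants and the final probability bound\<close>

theorem lemma3:
  fixes A :: "real^'n^'n" and B :: "real^'m^'n"
    and Q :: "real^'n^'n" and R :: "real^'m^'m" and P :: "real^'n^'n"
    and lam :: real and \<Sigma>\<^sub>\<epsilon> :: "real^'m^'m"
    and X :: "(real^'n) set"
    and US :: "(real^('h::{finite,linorder} \<times> 'm)) set"
  assumes "psd Q" and "pd R"
    and "stabilizable A B"
    and "detectable A (psd_sqrt Q)"
    and "pd P" and "dare A B Q R P"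
    and "\<And>P'. pd P' \<Longrightarrow> dare A B Q R P' \<Longrightarrow> P' = P"
    and "lam > 0"
    and "pd \<Sigma>\<^sub>\<epsilon>"
    and "compact X" and "bounded US"
  shows "\<exists>C>0. \<forall>\<eta>. 0 < \<eta> \<and> \<eta> < 1 \<longrightarrow>
    (\<exists>M\<^sub>0::nat. \<forall>M\<ge>M\<^sub>0. \<forall>x\<in>X. \<forall>U\<in>US.
      \<forall>(\<Omega>::'w measure) (E::nat \<Rightarrow> 'w \<Rightarrow> real^('h \<times> 'm)).
        iid_noise \<Sigma>\<^sub>\<epsilon> \<Omega> M E \<longrightarrow>
        measure \<Omega> {\<omega>\<in>space \<Omega>.
          norm (u_mppi A B Q R P lam x U M (\<lambda>j. E j \<omega>) - u_inf A B Q R P lam \<Sigma>\<^sub>\<epsilon> x U)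
            \<le> C * sqrt (ln (4 * real CARD('m) / \<eta>) / real M) \<and>
          norm (u_mppi A B Q R P lam x U M (\<lambda>j. E j \<omega>) - u_lqr A B R P x)
            \<le> bias_inf A B Q R P lam \<Sigma>\<^sub>\<epsilon> x U
               + C * sqrt (ln (4 * real CARD('m) / \<eta>) / real M)}
        \<ge> 1 - \<eta>)"
proof -
  let ?\<mu> = "noise_law \<Sigma>\<^sub>\<epsilon> :: (real^('h \<times> 'm)) measure"
  let ?w = "mppi_weight A B Q R P lam"
  let ?L = "\<lambda>\<eta>. ln (4 * real CARD('m) / \<eta>)"
  have sets\<mu>: "sets ?\<mu> = sets borel" by (simp add: noise_law_def gaussian_def)
  have rv: "E j \<in> measurable \<Omega> borel"
    if "iid_noise \<Sigma>\<^sub>\<epsilon> \<Omega> M E" "j \<in> {1..M}"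
    for \<Omega> :: "'w measure" and M j and E :: "nat \<Rightarrow> 'w \<Rightarrow> real^('h \<times> 'm)"
    using that unfolding iid_noise_def by (auto simp: prob_space.indep_vars_def)
  show ?thesis
  proof (cases "prob_space ?\<mu>")
    case False
    \<comment> \<open>Vacuous: \<open>iid_noise\<close> makes \<open>noise_law \<Sigma>\<^sub>\<epsilon>\<close> a probability. Arguing this way avoids evaluating
      the Gaussian integral.\<close>
    have "\<not> iid_noise \<Sigma>\<^sub>\<epsilon> \<Omega> M E" if "1 \<le> M"
      for \<Omega> :: "'w measure" and M and E :: "nat \<Rightarrow> 'w \<Rightarrow> real^('h \<times> 'm)"
    proof
      assume iid: "iid_noise \<Sigma>\<^sub>\<epsilon> \<Omega> M E"
      then have "prob_space \<Omega>" "distr \<Omega> borel (E 1) = ?\<mu>"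
        using that by (auto simp: iid_noise_def)
      with prob_space.prob_space_distr[OF _ rv[OF iid]] that False show False by fastforce
    qed
    \<comment> \<open>The threshold 1 excludes \<open>M = 0\<close>, where \<open>iid_noise\<close>
      puts no constraint on the law.\<close>
    then show ?thesis by (intro exI[of _ 1] conjI allI impI exI[of _ "1::nat"]) auto
  next
    case True
    obtain c where c: "0 < c"
        "\<And>x U. x \<in> X \<Longrightarrow> U \<in> US \<Longrightarrow> c \<le> (LINT e|?\<mu>. ?w x U e)"
      using mppi_weight_expectation_bounded_below
        [OF assms(1,2,5,8,10,11) True sets\<mu>, where A = A and B = B]
      by blast
    obtain r where r: "0 < r" "\<And>v. r * (norm v)\<^sup>2 \<le> v \<bullet> (R *v v)" using pd_coercive[OF \<open>pd R\<close>] by metis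
    obtain K where K: "0 < K" "\<And>U. U \<in> US \<Longrightarrow> norm U \<le> K"
      using \<open>bounded US\<close> by (auto simp: bounded_pos)
    \<comment> \<open>This is the weighted-noise bound with \<open>norm U\<close> replaced by its
      supremum bound \<open>K\<close>.\<close>
    define D where "D = 1 + lam / r + K"
    have D: "0 < D" using r K \<open>lam > 0\<close> by (simp add: D_def add_pos_pos)
    \<comment> \<open>\<open>c\<close> and \<open>D\<close> are already uniform over
      \<open>X\<close> and \<open>US\<close>, so \<open>C\<close> is fixed before \<eta>, which
      affects only the sample threshold.\<close>
    define C where "C = 2 * sqrt 2 * real CARD('m) * D / c + sqrt 2 * D / c\<^sup>2"
    have C: "0 < C" using c D by (auto simp: C_def intro!: add_pos_pos)
    show ?thesis
    proof (intro exI[of _ C] conjI C allI impI)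
      fix \<eta> :: real assume \<eta>: "0 < \<eta> \<and> \<eta> < 1"
      \<comment> \<open>The ceiling gives the sample size required for concentration; the maximum
        with 1 keeps the set of sample indices nonempty.\<close>
      let ?M0 = "max 1 (nat \<lceil>2 * ?L \<eta> / c\<^sup>2\<rceil>)"
      show "\<exists>M\<^sub>0::nat. \<forall>M\<ge>M\<^sub>0. \<forall>x\<in>X. \<forall>U\<in>US.
        \<forall>(\<Omega>::'w measure) (E::nat \<Rightarrow> 'w \<Rightarrow> real^('h \<times> 'm)).
          iid_noise \<Sigma>\<^sub>\<epsilon> \<Omega> M E \<longrightarrow>
          measure \<Omega> {\<omega>\<in>space \<Omega>.
            norm (u_mppi A B Q R P lam x U M (\<lambda>j. E j \<omega>) - u_inf A B Q R P lam \<Sigma>\<^sub>\<epsilon> x U)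
              \<le> C * sqrt (?L \<eta> / real M) \<and>
            norm (u_mppi A B Q R P lam x U M (\<lambda>j. E j \<omega>) - u_lqr A B R P x)
              \<le> bias_inf A B Q R P lam \<Sigma>\<^sub>\<epsilon> x U + C * sqrt (?L \<eta> / real M)} \<ge> 1 - \<eta>"
      proof (intro exI[of _ ?M0] allI impI ballI)
        fix M x U and \<Omega> :: "'w measure" and E :: "nat \<Rightarrow> 'w \<Rightarrow> real^('h \<times> 'm)"
        assume M: "?M0 \<le> M" and x: "x \<in> X" and U: "U \<in> US" and iid: "iid_noise \<Sigma>\<^sub>\<epsilon> \<Omega> M E"
        let ?dev = "\<lambda>\<omega>. norm (u_mppi A B Q R P lam x U M (\<lambda>j. E j \<omega>) - u_inf A B Q R P lam \<Sigma>\<^sub>\<epsilon> x U)"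
        have iid': "prob_space \<Omega>" "prob_space.indep_vars \<Omega> (\<lambda>_. borel) E {1..M}"
            "\<And>j. j \<in> {1..M} \<Longrightarrow> distr \<Omega> borel (E j) = ?\<mu>"
          using iid by (auto simp: iid_noise_def)
        have "1 - \<eta> \<le> measure \<Omega> {\<omega> \<in> space \<Omega>. ?dev \<omega> \<le> C * sqrt (?L \<eta> / real M)}"
        proof -
          have bound: "norm (?w x U e *\<^sub>R ublock e 0) \<le> D" for e
            using norm_weighted_noise_le[OF assms(1,2,5,8) r, of A B x U e] K(2)[OF U]
            by (simp add: D_def)
          have big: "2 * ?L \<eta> / c\<^sup>2 \<le> real (card {1..M})" and ne: "{1..M} \<noteq> {}"
            using M by (auto simp: nat_le_iff ceiling_le_iff)
          have g: "(\<lambda>e. ?w x U e *\<^sub>R ublock e 0) \<in> borel_measurable borel" by measurable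
          show ?thesis
            using self_normalised_concentration[OF iid'(1,2) finite_atLeastAtMost ne iid'(3)
                borel_measurable_mppi_weight mppi_weight_bounds[OF assms(1,2,5,8)] g bound D
                c(1) c(2)[OF x U] conjunct1[OF \<eta>] conjunct2[OF \<eta>] big]
            by (simp add: u_mppi_def u_inf_def C_def)
        qed
        \<comment> \<open>Pointwise, the first inequality implies the second by the triangle
          inequality through \<open>u_inf\<close>. The joint event is therefore the same set, and no
          further probability is lost.\<close>
        also have "{\<omega> \<in> space \<Omega>. ?dev \<omega> \<le> C * sqrt (?L \<eta> / real M)}
          = {\<omega> \<in> space \<Omega>. ?dev \<omega> \<le> C * sqrt (?L \<eta> / real M) \<and>
              norm (u_mppi A B Q R P lam x U M (\<lambda>j. E j \<omega>) - u_lqr A B R P x)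
                \<le> bias_inf A B Q R P lam \<Sigma>\<^sub>\<epsilon> x U + C * sqrt (?L \<eta> / real M)}"
          unfolding bias_inf_def by (auto intro: norm_diff_triangle_le[THEN order_trans] simp: add.commute)
        finally show "1 - \<eta> \<le> measure \<Omega> {\<omega> \<in> space \<Omega>. ?dev \<omega> \<le> C * sqrt (?L \<eta> / real M) \<and>
              norm (u_mppi A B Q R P lam x U M (\<lambda>j. E j \<omega>) - u_lqr A B R P x)
                \<le> bias_inf A B Q R P lam \<Sigma>\<^sub>\<epsilon> x U + C * sqrt (?L \<eta> / real M)}" .
      qed
    qed
  qed
qed

end
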